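(* Let $q=p^k$ for some prime $p$ and some integer $k>0$. Let $Q,R,S$ be integers each of the form $p^i$ for some integer $i\ge 0$ (the exponents may differ). Let $r>0$ be an integer with $r\equiv Q+R+S\pmod{q+1}$. Let $m\ge 3$ be an integer with $q\equiv 1\pmod m$ or $q\equiv -1\pmod m$. Let $v$ be a primitive $m$-th root of unity in $\mathbb{F}_{q^2}$ and put $b:=(1-v^4)/(v^3-v)$; then $b\in\{0,1,-1\}$ if and only if $m\in\{3,4,6\}$. Let $f(X):=X^rB(X^{q-1})$, where one of the following holds: (1) $B(X):=X^{Q+R}-X^{Q+S}-X^{R+S}+bX^S-1$ and $(Q,R,S)\equiv\pm(1,1,1)\pmod m$; (2) $B(X):=X^{R+S}-X^{Q+R}-X^{Q+S}+bX^Q-1$ and $(Q,R,S)\equiv\pm(1,-1,1)\pmod m$; (3) $B(X):=X^{Q+R+S}-X^Q-X^R-X^S+b$ and $(Q,R,S)\equiv\pm(1,1,-1)\pmod m$. Then $f(X)$ permutes $\mathbb{F}_{q^2}$ if and only if $q\equiv 1\pmod m$ and $\gcd(r,q-1)=1$ and $\gcd(Q+R-S,q+1)=1$.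
   Context: A polynomial $f(X)\in\mathbb{F}_{q^2}[X]$ permutes $\mathbb{F}_{q^2}$ if the map $\alpha\mapsto f(\alpha)$ is a bijection of $\mathbb{F}_{q^2}$. For integers $\epsilon_1,\epsilon_2,\epsilon_3$, the notation $(Q,R,S)\equiv\pm(\epsilon_1,\epsilon_2,\epsilon_3)\pmod m$ means that there is a single sign $s\in\{1,-1\}$ with $Q\equiv s\epsilon_1$, $R\equiv s\epsilon_2$, $S\equiv s\epsilon_3\pmod m$. *)

theory Defs
  imports
    "HOL-Computational_Algebra.Polynomial"
    "HOL-Computational_Algebra.Primes"
    "HOL-Number_Theory.Cong"
    "HOL-Library.Cardinality"
begin

definition permutation_poly :: "'a :: finite_field poly \<Rightarrow> bool" where
  "permutation_poly f \<longleftrightarrow> bij (poly f)"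

definition primitive_root_of_unity :: "nat \<Rightarrow> 'a :: field \<Rightarrow> bool" where
  "primitive_root_of_unity m v \<longleftrightarrow>
     m > 0 \<and> v ^ m = 1 \<and> (\<forall>j. 0 < j \<and> j < m \<longrightarrow> v ^ j \<noteq> 1)"

text \<open>One sign \<open>s\<close> serves all three coordinates.\<close>

definition cong_pm :: "int \<times> int \<times> int \<Rightarrow> int \<times> int \<times> int \<Rightarrow> int \<Rightarrow> bool" where
  "cong_pm = (\<lambda>(Q, R, S) (e1, e2, e3) m.
     \<exists>s \<in> {1, -1}. [Q = s * e1] (mod m) \<and> [R = s * e2] (mod m) \<and> [S = s * e3] (mod m))"

abbreviation mon :: "nat \<Rightarrow> 'a :: comm_ring_1 poly" where
  "mon n \<equiv> monom 1 n"

end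

theory Submission
  imports Defs
begin

text \<open>
  Write \<open>U\<close> for the group of \<open>(q + 1)\<close>-th roots of unity in the field with \<open>q\<^sup>2\<close> elements. The
  map \<open>y \<mapsto> y ^ (q - 1)\<close> sends the nonzero elements onto \<open>U\<close>, with the cosets of the \<open>(q - 1)\<close>-th
  roots of unity as fibres, and \<open>f\<close> lies over the map \<open>g(x) = x ^ r * B(x) ^ (q - 1)\<close> on \<open>U\<close>. If
  \<open>B\<close> has no zero in \<open>U\<close>, then \<open>f\<close> is a permutation iff \<open>gcd r (q - 1) = 1\<close> and \<open>g\<close> permutes \<open>U\<close>
  (\<open>bij_poly_iff_inj_on_roots_of_unity\<close>).

  On \<open>U\<close> the Frobenius map \<open>x \<mapsto> x ^ q\<close> is inversion, so \<open>g = N / B\<close> where \<open>N(x) = x ^ r * B(x) ^ q\<close>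
  is \<open>B\<close> with its coefficients reversed. With \<open>X = x ^ Q\<close>, \<open>Y = x ^ R\<close>, \<open>Z = x ^ S\<close> both \<open>N\<close> and \<open>B\<close>
  are trilinear, and because \<open>b = - (v + 1 / v)\<close> exactly the two members \<open>N + v * B\<close> and
  \<open>v * N + B\<close> of the pencil they span split into linear factors
  (\<open>trilinear_factorizations\<close>). The congruences on \<open>Q\<close>, \<open>R\<close>, \<open>S\<close> say that raising to each of these
  powers of the characteristic sends \<open>v\<close> to \<open>v\<close> or to \<open>1 / v\<close>, so every linear factor is, up to a
  constant, a power of \<open>x + v\<close> or of \<open>v * x + 1\<close> (\<open>linear_factor_power\<close>). Hence
  \<open>\<sigma>(x) = (x + v) / (v * x + 1)\<close> satisfies \<open>\<sigma>(g(x)) = \<sigma>(x) powi e\<close> with \<open>e = Q + R - S\<close> or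
  \<open>e = - (Q + R - S)\<close>; the constants cancel.

  If \<open>q \<equiv> 1\<close> modulo \<open>m\<close>, then \<open>v\<close> lies in the subfield with \<open>q\<close> elements, \<open>\<sigma>\<close> permutes \<open>U\<close>, \<open>B\<close> has
  no zero in \<open>U\<close>, and \<open>g\<close> permutes \<open>U\<close> iff the power map with exponent \<open>e\<close> does, that is, iff
  \<open>gcd e (q + 1) = 1\<close>. If \<open>q \<equiv> - 1\<close> modulo \<open>m\<close>, then \<open>- v\<close> lies in \<open>U\<close>, both split members vanish there,
  and therefore so does \<open>B\<close>; this gives \<open>f\<close> a nonzero root in addition to the root \<open>0\<close>.
\<close>

section \<open>Frobenius and power maps on finite fields\<close>

lemma add_power_CHAR_power:
  fixes x y :: "'a :: finite_field"
  shows "(x + y) ^ (CHAR('a) ^ n) = x ^ (CHAR('a) ^ n) + y ^ (CHAR('a) ^ n)"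
proof (induction n)
  case (Suc n)
  let ?p = "CHAR('a)"
  have p: "prime ?p" by simp
  have dream: "(x + y) ^ ?p = x ^ ?p + y ^ ?p" for x y :: 'a
  proof -
    have "(x + y) ^ ?p = (\<Sum>k\<le>?p. of_nat (?p choose k) * x ^ k * y ^ (?p - k))"
      by (rule binomial_ring)
    also have "\<dots> = (\<Sum>k\<in>{0, ?p}. of_nat (?p choose k) * x ^ k * y ^ (?p - k))"
    proof (rule sum.mono_neutral_right)
      show "\<forall>k\<in>{..?p} - {0, ?p}. of_nat (?p choose k) * x ^ k * y ^ (?p - k) = 0"
      proof
        fix k assume "k \<in> {..?p} - {0, ?p}"
        then have "?p dvd (?p choose k)"
          using p by (intro dvd_choose_prime) auto
        then have "of_nat (?p choose k) = (0 :: 'a)"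
          by (simp add: of_nat_eq_0_iff_char_dvd)
        then show "of_nat (?p choose k) * x ^ k * y ^ (?p - k) = 0" by simp
      qed
    qed auto
    also have "\<dots> = x ^ ?p + y ^ ?p"
      using p by (auto simp: prime_gt_0_nat add.commute)
    finally show ?thesis .
  qed
  have "(x + y) ^ (?p ^ Suc n) = ((x + y) ^ (?p ^ n)) ^ ?p"
    by (simp add: power_mult [symmetric] mult.commute)
  also have "\<dots> = x ^ (?p ^ Suc n) + y ^ (?p ^ Suc n)"
    by (simp only: Suc.IH dream) (simp add: power_mult [symmetric] mult.commute)
  finally show ?case .
qed simp

lemma minus_power_CHAR_power:
  fixes x :: "'a :: finite_field"
  shows "(- x) ^ (CHAR('a) ^ n) = - (x ^ (CHAR('a) ^ n))"
proof -
  have "x ^ (CHAR('a) ^ n) + (- x) ^ (CHAR('a) ^ n) = 0"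
    using add_power_CHAR_power[of x "- x" n] by (simp add: power_0_left)
  then show ?thesis by (simp add: eq_neg_iff_add_eq_0 add.commute)
qed

lemma CHAR_eq_of_CARD_prime_power:
  assumes "prime p" "CARD('a :: finite_field) = p ^ n"
  shows "CHAR('a) = p"
proof -
  have "(\<Sum>x\<in>UNIV. x + 1) = (\<Sum>x\<in>UNIV. x :: 'a)"
    by (rule sum.reindex_bij_witness[of _ "\<lambda>x. x - 1" "\<lambda>x. x + 1"]) auto
  then have "of_nat CARD('a) = (0 :: 'a)"
    by (simp add: sum.distrib)
  then have "CHAR('a) dvd p ^ n"
    unfolding assms(2) of_nat_eq_0_iff_char_dvd .
  then have "CHAR('a) dvd p"
    by (rule prime_dvd_power[OF CHAR_prime])
  then show ?thesis
    using assms(1) primes_dvd_imp_eq[OF CHAR_prime] by blast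
qed

lemma card_power_eq_le:
  fixes c :: "'a :: finite_field"
  assumes "n > 0"
  shows "card {x. x ^ n = c} \<le> n"
proof -
  let ?P = "monom 1 n - [:c:] :: 'a poly"
  have "coeff ?P n = 1"
    using assms by (cases n) auto
  then have "?P \<noteq> 0" by (metis coeff_0 zero_neq_one)
  moreover have "degree ?P \<le> n"
    by (intro degree_diff_le degree_monom_le) auto
  moreover have "{x. x ^ n = c} = {x. poly ?P x = 0}"
    by (auto simp: poly_monom)
  ultimately show ?thesis
    using card_poly_roots_bound[of ?P] by simp
qed

text \<open>
  The \<open>n'\<close>-th power map sends the nonzero elements into the \<open>n\<close>-th roots of unity with fibres of size
  at most \<open>n'\<close>, so its image has at least \<open>n\<close> elements, while a polynomial of degree \<open>n\<close> has at most
  \<open>n\<close> roots. This counting yields both conclusions without a generator of the multiplicative group.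
\<close>

lemma roots_of_unity_of_cofactor:
  assumes "n > 0" "n' > 0" "CARD('a :: finite_field) - 1 = n * n'"
  shows "(\<lambda>y :: 'a. y ^ n') ` (UNIV - {0}) = {x. x ^ n = 1}"
    and "card {x :: 'a. x ^ n = 1} = n"
proof -
  let ?I = "(\<lambda>y :: 'a. y ^ n') ` (UNIV - {0})" and ?U = "{x :: 'a. x ^ n = 1}"
  have fermat: "y ^ (n * n') = 1" if "y \<noteq> 0" for y :: 'a
  proof -
    have "y ^ CARD('a) = y" by (rule finite_field_power_card_eq_same)
    moreover have "CARD('a) = Suc (n * n')"
      using assms(3) finite_UNIV_card_ge_0[OF finite, where ?'a1 = 'a] by linarith
    ultimately show ?thesis using that by simp
  qed
  have sub: "?I \<subseteq> ?U"
    using fermat by (auto simp: power_mult [symmetric] mult.commute)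
  have "n * n' = card (UNIV - {0 :: 'a})"
    using assms(3) by (simp add: card_Diff_singleton)
  also have "UNIV - {0 :: 'a} \<subseteq> (\<Union>c\<in>?I. {y. y ^ n' = c})" by auto
  then have "card (UNIV - {0 :: 'a}) \<le> card (\<Union>c\<in>?I. {y. y ^ n' = c})"
    by (intro card_mono) auto
  also have "\<dots> \<le> (\<Sum>c\<in>?I. card {y. y ^ n' = c})"
    by (rule card_UN_le) auto
  also have "\<dots> \<le> (\<Sum>c\<in>?I. n')"
    by (intro sum_mono card_power_eq_le assms)
  also have "\<dots> = card ?I * n'" by simp
  finally have ge: "n \<le> card ?I" using assms(2) by simp
  have le: "card ?U \<le> n" using card_power_eq_le assms(1) by blast
  have "card ?I \<le> card ?U" using sub by (intro card_mono) auto
  then show "card ?U = n" using ge le by simp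
  show "?I = ?U"
    using sub ge le by (intro card_seteq) auto
qed

lemma ex_nontrivial_root_of_unity:
  assumes "d > 1" "d dvd CARD('a :: finite_field) - 1" "CARD('a) > 1"
  shows "\<exists>w :: 'a. w \<noteq> 1 \<and> w ^ d = 1"
proof -
  obtain d' where d': "CARD('a) - 1 = d * d'" using assms(2) by blast
  have "d' > 0" using d' assms(3) by (cases d') auto
  then have "card {x :: 'a. x ^ d = 1} = d"
    using roots_of_unity_of_cofactor(2) d' assms(1) by (metis less_trans zero_less_one)
  then have "\<not> {x :: 'a. x ^ d = 1} \<subseteq> {1}"
    using assms(1) card_mono[of "{1 :: 'a}" "{x. x ^ d = 1}"] by auto
  then show ?thesis by blast
qed

lemma power_int_eq_1_gcd:
  fixes w :: "'a :: field"
  assumes "w \<noteq> 0" "w powi a = 1" "w powi c = 1"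
  shows "w powi gcd a c = 1"
proof -
  obtain s t where st: "s * a + t * c = gcd a c" using bezout_int by blast
  have "w powi (a * s + c * t) = (w powi a) powi s * (w powi c) powi t"
    using assms(1) by (simp add: power_int_add power_int_mult)
  then show ?thesis using assms st by (simp add: mult.commute)
qed

text \<open>
  By Bezout the kernel of the power map consists of the roots of unity of order dividing
  \<open>gcd e n\<close>, and every divisor \<open>d > 1\<close> of \<open>n\<close> has a nontrivial \<open>d\<close>-th root of unity.
\<close>

lemma inj_on_powi_roots_of_unity_iff:
  assumes n: "n > 0" "n dvd CARD('a :: finite_field) - 1" "CARD('a) > 1"
  shows "inj_on (\<lambda>z :: 'a. z powi e) {z. z ^ n = 1} \<longleftrightarrow> gcd e (int n) = 1"
proof
  assume inj: "inj_on (\<lambda>z :: 'a. z powi e) {z. z ^ n = 1}"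
  show "gcd e (int n) = 1"
  proof (rule ccontr)
    assume ne: "gcd e (int n) \<noteq> 1"
    define d where "d = nat (gcd e (int n))"
    have d: "int d = gcd e (int n)" by (simp add: d_def)
    have "int d > 0" using n(1) unfolding d by (simp add: gcd_pos_int)
    then have d1: "d > 1" using ne d by linarith
    have dn: "d dvd n" using d gcd_dvd2[of e "int n"] by (metis int_dvd_int_iff)
    obtain w :: 'a where w: "w \<noteq> 1" "w ^ d = 1"
      using ex_nontrivial_root_of_unity[of d] d1 dn n by (meson dvd_trans)
    obtain c where "e = int d * c" using d gcd_dvd1[of e "int n"] by (metis dvdE)
    then have "w powi e = 1" using w by (simp add: power_int_mult)
    moreover have "w ^ n = 1" using dn w(2) by (auto elim!: dvdE simp: power_mult)
    ultimately show False using inj w(1) by (auto simp: inj_on_def)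
  qed
next
  assume g: "gcd e (int n) = 1"
  show "inj_on (\<lambda>z :: 'a. z powi e) {z. z ^ n = 1}"
  proof (rule inj_onI, clarsimp)
    fix x y :: 'a assume x: "x ^ n = 1" and y: "y ^ n = 1" and eq: "x powi e = y powi e"
    have nz: "x \<noteq> 0" "y \<noteq> 0" using x y n(1) by (auto simp: power_0_left)
    have "(x / y) powi e = 1" using eq nz by (simp add: power_int_divide_distrib)
    moreover have "(x / y) powi (int n) = 1" using x y by (simp add: power_divide)
    ultimately have "(x / y) powi (gcd e (int n)) = 1"
      using nz by (intro power_int_eq_1_gcd) auto
    then show "x = y" using g nz by simp
  qed
qed

section \<open>Permutation polynomials of cyclotomic form\<close>

lemma card_minus_one_factor:
  assumes "CARD('a :: finite_field) = q ^ 2"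
  shows "CARD('a) - 1 = (q + 1) * (q - 1)"
  unfolding assms by (cases q) (simp_all add: power2_eq_square)

lemma poly_cyclotomic_form:
  "poly (mon r * pcompose B (mon n)) y = y ^ r * poly B (y ^ n)"
  by (simp add: poly_pcompose poly_monom)

text \<open>
  The identity \<open>f(y) ^ (q - 1) = g(y ^ (q - 1))\<close> puts \<open>f\<close> over \<open>g\<close>, and multiplying \<open>y\<close> by a
  \<open>(q - 1)\<close>-th root of unity \<open>w\<close> multiplies \<open>f(y)\<close> by \<open>w ^ r\<close>. So \<open>gcd r (q - 1) = 1\<close> governs
  injectivity of \<open>f\<close> on the fibres of \<open>y \<mapsto> y ^ (q - 1)\<close> and \<open>g\<close> governs injectivity across them.
\<close>

lemma bij_poly_iff_inj_on_roots_of_unity: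
  fixes B :: "'a :: finite_field poly"
  assumes card: "CARD('a) = q ^ 2" and q: "q > 1" and r: "r > 0"
    and nz: "\<And>x. x ^ (q + 1) = 1 \<Longrightarrow> poly B x \<noteq> 0"
  shows "bij (poly (mon r * pcompose B (mon (q - 1)))) \<longleftrightarrow>
    gcd r (q - 1) = 1 \<and> inj_on (\<lambda>x. x ^ r * poly B x ^ (q - 1)) {x. x ^ (q + 1) = 1}"
proof -
  define F where "F = poly (mon r * pcompose B (mon (q - 1)))"
  define g where "g = (\<lambda>x. x ^ r * poly B x ^ (q - 1))"
  let ?U = "{x :: 'a. x ^ (q + 1) = 1}"
  have F: "F y = y ^ r * poly B (y ^ (q - 1))" for y
    unfolding F_def by (rule poly_cyclotomic_form)
  note fac = card_minus_one_factor[OF card]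
  have img: "(\<lambda>y :: 'a. y ^ (q - 1)) ` (UNIV - {0}) = ?U"
    using roots_of_unity_of_cofactor(1)[of "q + 1" "q - 1"] fac q by simp
  then have mu: "y ^ (q - 1) \<in> ?U" if "y \<noteq> 0" for y :: 'a using that by blast
  have Fnz: "F y = 0 \<longleftrightarrow> y = 0" for y
    using nz mu[of y] r by (auto simp: F)
  have Fg: "F y ^ (q - 1) = g (y ^ (q - 1))" for y
    by (simp add: F g_def power_mult_distrib power_mult [symmetric] mult.commute)
  have "bij F \<longleftrightarrow> gcd r (q - 1) = 1 \<and> inj_on g ?U"
  proof
    assume bij: "bij F"
    have "gcd r (q - 1) = 1"
    proof (rule ccontr)
      assume ne: "gcd r (q - 1) \<noteq> 1"
      define d where "d = gcd r (q - 1)"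
      have d: "d dvd r" "d dvd q - 1" "d > 0" using r by (auto simp: d_def)
      moreover have "d \<noteq> 1" using ne by (simp add: d_def)
      ultimately have "d > 1" by linarith
      moreover have "d dvd CARD('a) - 1" using fac d(2) by simp
      moreover have "CARD('a) > 1" unfolding card using q by (intro one_less_power) auto
      ultimately obtain w :: 'a where w: "w \<noteq> 1" "w ^ d = 1"
        using ex_nontrivial_root_of_unity by blast
      have "w ^ r = 1" "w ^ (q - 1) = 1"
        using d(1,2) w(2) by (auto elim!: dvdE simp: power_mult)
      then have "F w = F 1" by (simp add: F)
      then show False using bij w(1) by (auto simp: bij_def inj_def)
    qed
    \<comment> \<open>Surjectivity descends from \<open>f\<close> to \<open>g\<close>, and on a finite set it is the same as injectivity.\<close>
    moreover have "inj_on g ?U"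
    proof (rule eq_card_imp_inj_on)
      have "?U \<subseteq> g ` ?U"
      proof
        fix x assume "x \<in> ?U"
        then obtain z where z: "z \<noteq> 0" "x = z ^ (q - 1)" using img by blast
        obtain y where y: "z = F y" using bij by (metis bij_pointE)
        have "y \<noteq> 0" using z(1) y Fnz by auto
        then show "x \<in> g ` ?U" using z(2) y Fg mu by blast
      qed
      then show "card (g ` ?U) = card ?U"
        by (intro antisym card_image_le card_mono) auto
    qed simp
    ultimately show "gcd r (q - 1) = 1 \<and> inj_on g ?U" by blast
  next
    assume "gcd r (q - 1) = 1 \<and> inj_on g ?U"
    then have gcd: "gcd r (q - 1) = 1" and inj: "inj_on g ?U" by auto
    have "inj F"
    proof (rule injI)
      fix y z assume eq: "F y = F z"
      show "y = z"
      proof (cases "y = 0 \<or> z = 0")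
        case True then show ?thesis using eq Fnz by metis
      next
        case False
        then have yz: "y \<noteq> 0" "z \<noteq> 0" by auto
        have "g (y ^ (q - 1)) = g (z ^ (q - 1))" using eq Fg by metis
        then have e1: "y ^ (q - 1) = z ^ (q - 1)"
          using inj_onD[OF inj] mu yz by blast
        then have e2: "y ^ r = z ^ r"
          using eq nz mu[OF yz(2)] by (simp add: F)
        have "(y / z) powi int r = 1" "(y / z) powi int (q - 1) = 1"
          using e1 e2 yz by (simp_all add: power_divide)
        then have "(y / z) powi gcd (int r) (int (q - 1)) = 1"
          using yz by (intro power_int_eq_1_gcd) auto
        moreover have "gcd (int r) (int (q - 1)) = 1" using gcd by (metis gcd_int_int_eq of_nat_1)
        ultimately show ?thesis using yz by simp
      qed
    qed
    then show "bij F" using finite_UNIV_inj_surj[of F] by (auto simp: bij_def)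
  qed
  then show ?thesis by (simp add: F_def g_def)
qed

section \<open>Maps conjugate to a power map on the roots of unity\<close>

text \<open>
  For \<open>v\<close> in the subfield with \<open>q\<close> elements, raising to the power \<open>q\<close> inverts \<open>x\<close> and fixes \<open>v\<close>, so
  up to the factor \<open>x\<close> it exchanges \<open>x + v\<close> and \<open>v * x + 1\<close>. Hence it inverts \<open>\<sigma> x\<close>, which puts \<open>\<sigma> x\<close>
  back into \<open>U\<close>, and one of the two linear forms can only vanish together with the other, which
  \<open>v\<^sup>2 \<noteq> 1\<close> excludes.
\<close>

lemma degree_one_map_roots_of_unity:
  fixes v :: "'a :: finite_field"
  assumes q: "q = CHAR('a) ^ k" and vq: "v ^ q = v" and v1: "v * v \<noteq> 1"
  defines "U \<equiv> {x. x ^ (q + 1) = 1}" and "\<sigma> \<equiv> (\<lambda>x. (x + v) / (v * x + 1))"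
  shows "x \<in> U \<Longrightarrow> x + v \<noteq> 0 \<and> v * x + 1 \<noteq> 0" and "inj_on \<sigma> U" and "\<sigma> ` U = U"
proof -
  have add: "(a + c) ^ q = a ^ q + c ^ q" for a c :: 'a
    unfolding q by (rule add_power_CHAR_power)
  have conj: "(x + v) ^ q * x = v * x + 1" if "x \<in> U" for x
    using that by (simp add: add vq U_def algebra_simps)
  have conj': "(v * x + 1) ^ q * x = x + v" if "x \<in> U" for x
    using that by (simp add: add vq U_def power_mult_distrib algebra_simps)
  have q0: "q > 0" using q by simp
  show nz: "x + v \<noteq> 0 \<and> v * x + 1 \<noteq> 0" if "x \<in> U" for x
  proof (rule ccontr)
    assume "\<not> ?thesis"
    then have "x + v = 0 \<and> v * x + 1 = 0"
      using conj[OF that] conj'[OF that] q0 by (auto simp: power_0_left)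
    then have "x = - v" "v * x = -1" by (auto simp: eq_neg_iff_add_eq_0)
    then show False using v1 by simp
  qed
  show inj: "inj_on \<sigma> U"
  proof (rule inj_onI)
    fix x y assume U: "x \<in> U" "y \<in> U" and "\<sigma> x = \<sigma> y"
    then have "(x + v) * (v * y + 1) = (y + v) * (v * x + 1)"
      using nz by (simp add: \<sigma>_def frac_eq_eq)
    then have "(1 - v * v) * (x - y) = 0" by (simp add: algebra_simps)
    then show "x = y" using v1 by simp
  qed
  have "\<sigma> ` U \<subseteq> U"
  proof clarify
    fix x assume x: "x \<in> U"
    have x0: "x \<noteq> 0" using x by (auto simp: U_def)
    have "\<sigma> x ^ q * x * (v * x + 1) ^ q = (x + v) ^ q * x"
      using nz[OF x] by (simp add: \<sigma>_def power_divide)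
    then have "\<sigma> x ^ q * (x + v) = v * x + 1"
      using conj[OF x] conj'[OF x] by (simp add: mult.assoc mult.commute[of x])
    then have "\<sigma> x ^ q * \<sigma> x = 1"
      using nz[OF x] unfolding \<sigma>_def times_divide_eq_right by simp
    then show "\<sigma> x \<in> U" by (simp add: U_def mult.commute)
  qed
  then show "\<sigma> ` U = U"
    using inj by (intro endo_inj_surj) auto
qed

text \<open>
  The two hypotheses on \<open>B\<close> are the cleared form of \<open>\<sigma>(g(x)) = \<sigma>(x) powi (i - j)\<close>. Keeping the
  denominators cleared lets the same hypotheses serve when \<open>v ^ q = 1 / v\<close>, where they force
  \<open>B(- v) = 0\<close>: there \<open>x + v\<close> is a factor of both right-hand sides, as \<open>i\<close> and \<open>j\<close> are positive.
\<close>

lemma permutation_poly_iff_of_power_conjugacy: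
  fixes B :: "'a :: finite_field poly" and v \<kappa> :: 'a and i j :: nat
  assumes card: "CARD('a) = q ^ 2" and q: "q = CHAR('a) ^ k" "q > 1" and r: "r > 0"
    and v1: "v * v \<noteq> 1" and vq: "v ^ q = v \<or> v ^ q * v = 1"
    and ij: "i > 0" "j > 0" and \<kappa>: "\<kappa> \<noteq> 0"
    and num: "\<And>x. x ^ (q + 1) = 1 \<Longrightarrow>
      x ^ r * poly B x ^ q + v * poly B x = \<kappa> * (x + v) ^ i * (v * x + 1) ^ j"
    and den: "\<And>x. x ^ (q + 1) = 1 \<Longrightarrow>
      v * (x ^ r * poly B x ^ q) + poly B x = \<kappa> * (v * x + 1) ^ i * (x + v) ^ j"
  shows "permutation_poly (mon r * pcompose B (mon (q - 1))) \<longleftrightarrow>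
    v ^ q = v \<and> gcd r (q - 1) = 1 \<and> gcd (int i - int j) (int q + 1) = 1"
proof (cases "v ^ q = v")
  case True
  define U where "U = {x :: 'a. x ^ (q + 1) = 1}"
  define \<sigma> where "\<sigma> = (\<lambda>x. (x + v) / (v * x + 1))"
  define g where "g = (\<lambda>x. x ^ r * poly B x ^ (q - 1))"
  note \<sigma> = degree_one_map_roots_of_unity[OF q(1) True v1, folded U_def \<sigma>_def]
  have nz: "poly B x \<noteq> 0" if "x \<in> U" for x
  proof
    assume "poly B x = 0"
    then have "\<kappa> * (x + v) ^ i * (v * x + 1) ^ j = 0"
      using num[of x] that q(2) by (simp add: U_def power_0_left)
    then show False using \<sigma>(1)[OF that] \<kappa> by simp
  qed
  have gU: "g x \<in> U" if "x \<in> U" for x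
  proof -
    have "poly B x ^ ((q - 1) * (q + 1)) = 1"
    proof -
      have "poly B x * poly B x ^ ((q - 1) * (q + 1)) = poly B x ^ CARD('a)"
        using q(2) card by (simp add: power2_eq_square algebra_simps flip: power_Suc)
      then show ?thesis using nz[OF that] by (simp add: finite_field_power_card_eq_same)
    qed
    moreover have "(x ^ r) ^ (q + 1) = 1"
      unfolding power_mult [symmetric] mult.commute[of r]
      using that unfolding power_mult U_def by simp
    ultimately have "(x ^ r * poly B x ^ (q - 1)) ^ (q + 1) = 1"
      unfolding power_mult_distrib power_mult by (simp only: mult_1)
    then show ?thesis by (simp only: U_def g_def mem_Collect_eq)
  qed
  have conj: "\<sigma> (g x) = \<sigma> x powi (int i - int j)" if "x \<in> U" for x
  proof -
    have x: "x ^ (q + 1) = 1" using that by (simp add: U_def)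
    have gB: "g x * poly B x = x ^ r * poly B x ^ q"
      using q(2) by (simp add: g_def mult.assoc flip: power_Suc2)
    have "\<sigma> (g x) = ((g x + v) * poly B x) / ((v * g x + 1) * poly B x)"
      using nz[OF that] by (simp add: \<sigma>_def)
    also have "\<dots> = (x ^ r * poly B x ^ q + v * poly B x) / (v * (x ^ r * poly B x ^ q) + poly B x)"
      by (simp add: distrib_right gB mult.assoc)
    also have "\<dots> = ((x + v) ^ i * (v * x + 1) ^ j) / ((v * x + 1) ^ i * (x + v) ^ j)"
      using \<kappa> by (simp only: num[OF x] den[OF x] mult.assoc) simp
    also have "\<dots> = \<sigma> x ^ i / \<sigma> x ^ j"
      by (simp add: \<sigma>_def power_divide)
    also have "\<dots> = \<sigma> x powi (int i - int j)"
      using \<sigma>(1)[OF that] by (simp add: \<sigma>_def power_int_diff)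
    finally show ?thesis .
  qed
  have "inj_on g U \<longleftrightarrow> inj_on (\<lambda>x. \<sigma> (g x)) U"
  proof -
    have "inj_on \<sigma> (g ` U)"
      using gU by (intro inj_on_subset[OF \<sigma>(2)]) blast
    then have "inj_on (\<sigma> \<circ> g) U \<longleftrightarrow> inj_on g U"
      using comp_inj_on inj_on_imageI2 by blast
    then show ?thesis by (simp add: comp_def)
  qed
  also have "\<dots> \<longleftrightarrow> inj_on ((\<lambda>z. z powi (int i - int j)) \<circ> \<sigma>) U"
    using conj by (intro inj_on_cong) simp
  also have "\<dots> \<longleftrightarrow> inj_on (\<lambda>z. z powi (int i - int j)) U"
    using comp_inj_on_iff[OF \<sigma>(2)] \<sigma>(3) by metis
  also have "\<dots> \<longleftrightarrow> gcd (int i - int j) (int (q + 1)) = 1"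
    unfolding U_def
  proof (rule inj_on_powi_roots_of_unity_iff)
    show "q + 1 dvd CARD('a) - 1"
      unfolding card_minus_one_factor[OF card] by (rule dvd_triv_left)
    show "CARD('a) > 1" unfolding card using q(2) by (intro one_less_power) auto
  qed simp
  finally show ?thesis
    using bij_poly_iff_inj_on_roots_of_unity[OF card q(2) r, of B] nz True
    by (simp add: U_def g_def permutation_poly_def add.commute)
next
  case False
  then have vv: "v ^ q * v = 1" using vq by simp
  have U: "(- v) ^ (q + 1) = 1"
    using vv unfolding q(1) by (simp add: minus_power_CHAR_power mult.commute)
  have "(-v) ^ r * poly B (-v) ^ q + v * poly B (-v) = 0"
    "v * ((-v) ^ r * poly B (-v) ^ q) + poly B (-v) = 0"
    using num[OF U] den[OF U] ij by (simp_all add: power_0_left)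
  moreover have "(1 - v * v) * d = 0" if "n + v * d = 0" "v * n + d = 0" for n d :: 'a
    using that by algebra
  ultimately have "(1 - v * v) * poly B (- v) = 0" by blast
  then have root: "poly B (- v) = 0" using v1 by simp
  have "(\<lambda>y :: 'a. y ^ (q - 1)) ` (UNIV - {0}) = {x. x ^ (q + 1) = 1}"
    using q by (intro roots_of_unity_of_cofactor(1) card_minus_one_factor[OF card]) auto
  then have "- v \<in> (\<lambda>y :: 'a. y ^ (q - 1)) ` (UNIV - {0})" using U by blast
  then obtain y where y: "y \<noteq> 0" "y ^ (q - 1) = - v"
    by (elim imageE) (metis DiffE singletonI)
  have "poly (mon r * pcompose B (mon (q - 1))) y = poly (mon r * pcompose B (mon (q - 1))) 0"
    using y root r by (simp only: poly_cyclotomic_form) simp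
  then have "\<not> permutation_poly (mon r * pcompose B (mon (q - 1)))"
    using y(1) by (auto simp: permutation_poly_def bij_def inj_def)
  then show ?thesis using False by simp
qed


section \<open>Trilinear factorizations\<close>

lemma power_eq_self_or_inverse_of_cong:
  fixes v :: "'a :: field"
  assumes "v ^ m = 1"
  shows "[int n = 1] (mod int m) \<Longrightarrow> v ^ n = v"
    and "[int n = - 1] (mod int m) \<Longrightarrow> v ^ n * v = 1"
proof -
  have dvd: "v ^ l = 1" if "m dvd l" for l
    using that assms by (auto elim!: dvdE simp: power_mult)
  show "v ^ n = v" if c: "[int n = 1] (mod int m)"
  proof (cases "n = 0")
    case True
    then have "m dvd 1" using c by (simp add: cong_iff_dvd_diff)
    then show ?thesis using dvd[of 1] True by simp
  next
    case False
    have "int m dvd int (n - 1)"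
      using c False by (simp add: cong_iff_dvd_diff of_nat_diff)
    then have "v ^ (n - 1) = 1" by (intro dvd) (simp only: int_dvd_int_iff)
    then show ?thesis using False by (cases n) simp_all
  qed
  show "v ^ n * v = 1" if c: "[int n = - 1] (mod int m)"
  proof -
    have "int m dvd int (n + 1)" using c by (simp add: cong_iff_dvd_diff add.commute)
    then have "v ^ (n + 1) = 1" by (intro dvd) (simp only: int_dvd_int_iff)
    then show ?thesis by (simp add: mult.commute)
  qed
qed

text \<open>
  Since the \<open>Q\<close>-th power map is additive, a linear form in \<open>x ^ Q\<close> is the \<open>Q\<close>-th power of the form
  whose coefficients are the \<open>Q\<close>-th roots; when \<open>v ^ Q = 1 / v\<close> the forms \<open>x + v\<close> and \<open>v * x + 1\<close> trade
  places at the cost of a factor \<open>v\<close>.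
\<close>

lemma linear_factor_power:
  fixes v x :: "'a :: finite_field"
  assumes Q: "Q = CHAR('a) ^ n"
  shows "v ^ Q = v \<Longrightarrow> x ^ Q + v = (x + v) ^ Q"
    and "v ^ Q = v \<Longrightarrow> v * x ^ Q + 1 = (v * x + 1) ^ Q"
    and "v ^ Q * v = 1 \<Longrightarrow> x ^ Q + v = v * (v * x + 1) ^ Q"
    and "v ^ Q * v = 1 \<Longrightarrow> v * x ^ Q + 1 = v * (x + v) ^ Q"
proof -
  have add: "(a + c) ^ Q = a ^ Q + c ^ Q" for a c :: 'a
    unfolding Q by (rule add_power_CHAR_power)
  show "v ^ Q = v \<Longrightarrow> x ^ Q + v = (x + v) ^ Q"
    and "v ^ Q = v \<Longrightarrow> v * x ^ Q + 1 = (v * x + 1) ^ Q"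
    and "v ^ Q * v = 1 \<Longrightarrow> x ^ Q + v = v * (v * x + 1) ^ Q"
    and "v ^ Q * v = 1 \<Longrightarrow> v * x ^ Q + 1 = v * (x + v) ^ Q"
    by (simp_all add: add power_mult_distrib algebra_simps)
qed

text \<open>
  Let \<open>D = X*Y*Z - X - Y - Z + b\<close> and let \<open>N\<close> be its reversal. Then \<open>N - c * D\<close> is a multiple of \<open>(X - c) * (Y - c) * (Z - c)\<close> exactly when
  \<open>c\<^sup>2 - b * c + 1 = 0\<close>, that is \<open>c = - v\<close> or \<open>c = - 1 / v\<close>. The second pair of identities is the first
  with \<open>Z\<close> replaced by \<open>1 / Z\<close> and denominators cleared.
\<close>

lemma trilinear_factorizations:
  fixes b v X Y Z :: "'a :: comm_ring_1"
  assumes b: "v * b = - (v * v + 1)"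
  shows "v * ((b*X*Y*Z - X*Y - X*Z - Y*Z + 1) + v * (X*Y*Z - X - Y - Z + b))
      = - (X + v) * (Y + v) * (Z + v)" (is ?A)
    and "v * (v * (b*X*Y*Z - X*Y - X*Z - Y*Z + 1) + (X*Y*Z - X - Y - Z + b))
      = - (v*X + 1) * (v*Y + 1) * (v*Z + 1)" (is ?B)
    and "v * ((b*X*Y - X*Y*Z - X - Y + Z) + v * (X*Y - X*Z - Y*Z + b*Z - 1))
      = - (X + v) * (Y + v) * (v*Z + 1)" (is ?C)
    and "v * (v * (b*X*Y - X*Y*Z - X - Y + Z) + (X*Y - X*Z - Y*Z + b*Z - 1))
      = - (v*X + 1) * (v*Y + 1) * (Z + v)" (is ?D)
proof -
  let ?c = "v * b + (v * v + 1)"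
  \<comment> \<open>Each identity holds for all \<open>b\<close> once a multiple of \<open>?c\<close> is added.\<close>
  have c: "?c = 0" using b by simp
  have "v * ((b*X*Y*Z - X*Y - X*Z - Y*Z + 1) + v * (X*Y*Z - X - Y - Z + b))
      = - (X + v) * (Y + v) * (Z + v) + ?c * (X*Y*Z + v)" by (simp add: algebra_simps)
  then show ?A by (simp only: c) simp
  have "v * (v * (b*X*Y*Z - X*Y - X*Z - Y*Z + 1) + (X*Y*Z - X - Y - Z + b))
      = - (v*X + 1) * (v*Y + 1) * (v*Z + 1) + ?c * (v*X*Y*Z + 1)" by (simp add: algebra_simps)
  then show ?B by (simp only: c) simp
  have "v * ((b*X*Y - X*Y*Z - X - Y + Z) + v * (X*Y - X*Z - Y*Z + b*Z - 1))
      = - (X + v) * (Y + v) * (v*Z + 1) + ?c * (X*Y + v*Z)" by (simp add: algebra_simps)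
  then show ?C by (simp only: c) simp
  have "v * (v * (b*X*Y - X*Y*Z - X - Y + Z) + (X*Y - X*Z - Y*Z + b*Z - 1))
      = - (v*X + 1) * (v*Y + 1) * (Z + v) + ?c * (v*X*Y + Z)" by (simp add: algebra_simps)
  then show ?D by (simp only: c) simp
qed

text \<open>
  Because \<open>x ^ q = 1 / x\<close>, the power \<open>B(x) ^ q\<close> is \<open>B\<close> evaluated at \<open>1 / x\<close>; multiplying by
  \<open>x ^ (Q + R + S)\<close> reverses the trilinear form.
\<close>

lemma numerator_on_roots_of_unity:
  fixes b v x :: "'a :: finite_field"
  assumes q: "q = CHAR('a) ^ k" and x: "x ^ (q + 1) = 1" and b: "b ^ q = b"
  shows "x ^ (Q + R + S) * poly (mon (Q + R + S) - mon Q - mon R - mon S + [:b:]) x ^ q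
      = b * x^Q * x^R * x^S - x^Q * x^R - x^Q * x^S - x^R * x^S + 1"
    and "x ^ (Q + R + S) * poly (mon (Q + R) - mon (Q + S) - mon (R + S) + smult b (mon S) - 1) x ^ q
      = b * x^Q * x^R - x^Q * x^R * x^S - x^Q - x^R + x^S"
proof -
  have add: "(a + c) ^ q = a ^ q + c ^ q" for a c :: 'a
    unfolding q by (rule add_power_CHAR_power)
  have neg: "(- a) ^ q = - (a ^ q)" for a :: 'a
    unfolding q by (rule minus_power_CHAR_power)
  have sub: "(a - c) ^ q = a ^ q - c ^ q" for a c :: 'a
    using add[of a "- c"] neg[of c] by simp
  have conj: "x ^ n * (x ^ n) ^ q = 1" for n
  proof -
    have "x ^ n * (x ^ n) ^ q = (x ^ (q + 1)) ^ n"
      by (simp add: power_mult_distrib power_mult [symmetric] mult.commute)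
    then show ?thesis using x by simp
  qed
  have rev3: "X*Y*Z * (X'*Y'*Z' - X' - Y' - Z' + b) = b*X*Y*Z - X*Y - X*Z - Y*Z + 1"
    and rev1: "X*Y*Z * (X'*Y' - X'*Z' - Y'*Z' + b*Z' - 1) = b*X*Y - X*Y*Z - X - Y + Z"
    if "X * X' = 1" "Y * Y' = 1" "Z * Z' = 1" for X X' Y Y' Z Z' :: 'a
  proof -
    have "X*Y*Z * (X'*Y'*Z' - X' - Y' - Z' + b)
      = b*X*Y*Z - X*Y*(Z*Z') - X*Z*(Y*Y') - Y*Z*(X*X') + (X*X')*(Y*Y')*(Z*Z')"
      by (simp add: algebra_simps)
    then show "X*Y*Z * (X'*Y'*Z' - X' - Y' - Z' + b) = b*X*Y*Z - X*Y - X*Z - Y*Z + 1"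
      by (simp only: that mult_1_right)
    have "X*Y*Z * (X'*Y' - X'*Z' - Y'*Z' + b*Z' - 1)
      = b*X*Y*(Z*Z') - X*Y*Z - X*(Y*Y')*(Z*Z') - Y*(X*X')*(Z*Z') + Z*(X*X')*(Y*Y')"
      by (simp add: algebra_simps)
    then show "X*Y*Z * (X'*Y' - X'*Z' - Y'*Z' + b*Z' - 1) = b*X*Y - X*Y*Z - X - Y + Z"
      by (simp only: that mult_1_right)
  qed
  show "x ^ (Q + R + S) * poly (mon (Q + R + S) - mon Q - mon R - mon S + [:b:]) x ^ q
      = b * x^Q * x^R * x^S - x^Q * x^R - x^Q * x^S - x^R * x^S + 1"
    using rev3[OF conj conj conj, of Q R S]
    by (simp add: poly_monom add sub b power_add power_mult_distrib)
  show "x ^ (Q + R + S) * poly (mon (Q + R) - mon (Q + S) - mon (R + S) + smult b (mon S) - 1) x ^ q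
      = b * x^Q * x^R - x^Q * x^R * x^S - x^Q - x^R + x^S"
    using rev1[OF conj conj conj, of Q R S]
    by (simp add: poly_monom add sub b power_add power_mult_distrib)
qed

text \<open>
  Cancelling \<open>v\<^sup>2 - 1\<close> shows \<open>b = - (v + 1 / v)\<close>. The values \<open>1\<close>, \<open>0\<close>, \<open>- 1\<close> of \<open>b\<close> then correspond to
  \<open>v\<close> being a root of \<open>v\<^sup>2 + v + 1\<close>, \<open>v\<^sup>2 + 1\<close>, \<open>v\<^sup>2 - v + 1\<close>, which divide \<open>v ^ 3 - 1\<close>, \<open>v ^ 4 - 1\<close>,
  \<open>v ^ 6 - 1\<close>. In characteristic \<open>2\<close> the first and third coincide, so \<open>b = - 1\<close> yields only that the
  order divides \<open>6\<close>.
\<close>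

lemma root_of_unity_trace:
  fixes v b :: "'a :: field"
  assumes v: "primitive_root_of_unity m v" and m: "m \<ge> 3"
    and b: "b = (1 - v ^ 4) / (v ^ 3 - v)"
  shows "v \<noteq> 0" "v * v \<noteq> 1" "v * b = - (v * v + 1)"
    and "b \<in> {0, 1, - 1} \<longleftrightarrow> m \<in> {3, 4, 6}"
proof -
  have vm: "v ^ m = 1" and min: "\<And>j. 0 < j \<Longrightarrow> j < m \<Longrightarrow> v ^ j \<noteq> 1"
    using v by (auto simp: primitive_root_of_unity_def)
  show v0: "v \<noteq> 0" using vm m by (auto simp: power_0_left)
  show vv: "v * v \<noteq> 1" using min[of 2] m by (simp add: power2_eq_square)
  have den: "v ^ 3 - v = v * (v * v - 1)" "v * (v * v - 1) \<noteq> 0"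
    using v0 vv by (simp_all add: algebra_simps power3_eq_cube)
  have "b * (v * (v * v - 1)) = 1 - v ^ 4"
    using den by (simp add: b)
  then have "(v * v - 1) * (v * b + (v * v + 1)) = 0" by algebra
  then have "v * b + (v * v + 1) = 0" using vv by simp
  then show vb: "v * b = - (v * v + 1)" by (simp only: eq_neg_iff_add_eq_0)
  have le: "m \<le> j" if "v ^ j = 1" "j > 0" for j using min[of j] that by linarith
  have dvd: "m dvd j" if "v ^ j = 1" for j
  proof -
    have "v ^ (m * (j div m) + j mod m) = 1" using that by simp
    then have "v ^ (j mod m) = 1" by (simp only: power_add power_mult vm) simp
    moreover have "j mod m < m" using m by simp
    ultimately have "j mod m = 0" using min by blast
    then show ?thesis by auto
  qed
  show "b \<in> {0, 1, - 1} \<longleftrightarrow> m \<in> {3, 4, 6}"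
  proof
    assume "b \<in> {0, 1, - 1}"
    then consider "b = 0" | "b = 1" | "b = - 1" by blast
    then show "m \<in> {3, 4, 6}"
    proof cases
      case 1
      then have "v * v = - 1" using vb by algebra
      then have "v ^ 4 = 1" by algebra
      then have "m dvd 4" "m \<le> 4" using dvd le by auto
      then have "m = 3 \<or> m = 4" using m by linarith
      then show ?thesis by auto
    next
      case 2
      then have "v ^ 3 = 1" using vb by algebra
      then have "m = 3" using le[of 3] m by simp
      then show ?thesis by simp
    next
      case 3
      then have "v ^ 6 = 1" using vb by algebra
      then have "m dvd 6" "m \<le> 6" using dvd le by auto
      moreover have "\<not> 4 dvd (6 :: nat)" "\<not> 5 dvd (6 :: nat)" by simp_all
      moreover have "m = 3 \<or> m = 4 \<or> m = 5 \<or> m = 6" using m \<open>m \<le> 6\<close> by linarith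
      ultimately show ?thesis by auto
    qed
  next
    assume "m \<in> {3, 4, 6}"
    then consider "m = 3" | "m = 4" | "m = 6" by blast
    then show "b \<in> {0, 1, - 1}"
    proof cases
      case 1
      then have "v ^ 3 = 1" using vm by simp
      then have "(v - 1) * (v * v + v + 1) = 0" by algebra
      moreover have "v \<noteq> 1" using min[of 1] 1 by simp
      ultimately have "v * v + v + 1 = 0" by simp
      then have "v * (b - 1) = 0" using vb by algebra
      then show ?thesis using v0 by simp
    next
      case 2
      then have "v ^ 4 = 1" using vm by simp
      then have "(v * v - 1) * (v * v + 1) = 0" by algebra
      then have "v * b = 0" using vv vb by simp
      then show ?thesis using v0 by simp
    next
      case 3
      then have "v ^ 6 = 1" using vm by simp
      then have "(v ^ 3 - 1) * ((v + 1) * (v * v - v + 1)) = 0" by algebra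
      moreover have "v ^ 3 \<noteq> 1" using min[of 3] 3 by simp
      moreover have "v + 1 \<noteq> 0" using vv by (auto simp: add_eq_0_iff2)
      ultimately have "v * v - v + 1 = 0" by simp
      then have "v * (b + 1) = 0" using vb by algebra
      then show ?thesis using v0 by (simp add: add_eq_0_iff2)
    qed
  qed
qed

theorem theorem1p3:
  fixes p k q Q R S r m :: nat
    and v b :: "'a :: finite_field"
    and B f :: "'a poly"
  assumes "prime p" and "k > 0" and "q = p ^ k"
    and "CARD('a) = q ^ 2"
    and "\<exists>i. Q = p ^ i" and "\<exists>i. R = p ^ i" and "\<exists>i. S = p ^ i"
    and "r > 0" and "[r = Q + R + S] (mod (q + 1))"
    and "m \<ge> 3" and "[int q = 1] (mod int m) \<or> [int q = -1] (mod int m)"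
    and "primitive_root_of_unity m v"
    and "b = (1 - v ^ 4) / (v ^ 3 - v)"
    and "f = mon r * pcompose B (mon (q - 1))"
  shows "(b \<in> {0, 1, -1} \<longleftrightarrow> m \<in> {3, 4, 6}) \<and>
    ((B = mon (Q + R) - mon (Q + S) - mon (R + S) + smult b (mon S) - 1
        \<and> cong_pm (int Q, int R, int S) (1, 1, 1) (int m)
      \<or> B = mon (R + S) - mon (Q + R) - mon (Q + S) + smult b (mon Q) - 1
        \<and> cong_pm (int Q, int R, int S) (1, -1, 1) (int m)
      \<or> B = mon (Q + R + S) - mon Q - mon R - mon S + [:b:]
        \<and> cong_pm (int Q, int R, int S) (1, 1, -1) (int m))
     \<longrightarrow>
     (permutation_poly f \<longleftrightarrow>
        [q = 1] (mod m) \<and> gcd r (q - 1) = 1 \<and> gcd (int Q + int R - int S) (int q + 1) = 1))"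
    (is "?trace \<and> (?cases \<longrightarrow> ?permutes)")
proof (intro conjI impI)
  note v = root_of_unity_trace[OF assms(12,10,13)]
  show ?trace by (rule v(4))
  have vm: "v ^ m = 1" using assms(12) by (simp add: primitive_root_of_unity_def)
  have CHAR: "CHAR('a) = p"
    using CHAR_eq_of_CARD_prime_power[of p "k * 2"] assms(1,3,4) by (simp add: power_mult)
  have q: "q = CHAR('a) ^ k" "q > 1"
    using assms(3) one_less_power[OF prime_gt_1_nat[OF assms(1)] assms(2)] by (simp_all add: CHAR)
  obtain nQ nR nS where QRS: "Q = CHAR('a) ^ nQ" "R = CHAR('a) ^ nR" "S = CHAR('a) ^ nS"
    using assms(5-7) CHAR by blast
  have pos: "Q > 0" "R > 0" "S > 0" by (simp_all add: QRS)
  have vq: "v ^ q = v \<or> v ^ q * v = 1"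
    using assms(11) power_eq_self_or_inverse_of_cong[OF vm, of q] by blast
  have vq_iff: "v ^ q = v \<longleftrightarrow> [q = 1] (mod m)"
  proof
    assume "v ^ q = v"
    then have "v ^ q * v \<noteq> 1" using v(2) by simp
    then have "[int q = 1] (mod int m)"
      using assms(11) power_eq_self_or_inverse_of_cong(2)[OF vm, of q] by blast
    then show "[q = 1] (mod m)" by (metis cong_int_iff of_nat_1)
  next
    assume "[q = 1] (mod m)"
    then have "[int q = 1] (mod int m)" by (metis cong_int_iff of_nat_1)
    then show "v ^ q = v" by (rule power_eq_self_or_inverse_of_cong(1)[OF vm])
  qed
  \<comment> \<open>\<open>b\<close> is symmetric under \<open>v \<mapsto> 1 / v\<close>, hence fixed by the \<open>q\<close>-th power map in either case.\<close>
  have bq: "b ^ q = b"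
  proof -
    have add: "(a + c) ^ q = a ^ q + c ^ q" for a c :: 'a
      unfolding q(1) by (rule add_power_CHAR_power)
    have "(v * b) ^ q = - (v ^ q * v ^ q + 1)"
      unfolding v(3) q(1) minus_power_CHAR_power
      by (simp add: add[unfolded q(1)] power_mult_distrib)
    then have vbq: "v ^ q * b ^ q = - (v ^ q * v ^ q + 1)"
      by (simp add: power_mult_distrib)
    from vq have "v * (b ^ q - b) = 0"
    proof
      assume "v ^ q = v"
      then show ?thesis using vbq v(3) by (simp add: right_diff_distrib)
    next
      assume "v ^ q * v = 1"
      moreover have "v * (c - b) = 0"
        if "w * v = 1" "w * c = - (w * w + 1)" "v * b = - (v * v + 1)" for w c :: 'a
        using that by algebra
      ultimately show ?thesis using vbq v(3) by blast
    qed
    then show ?thesis using v(1) by simp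
  qed
  have xr: "x ^ r = x ^ (Q + R + S)" if "x ^ (q + 1) = 1" for x :: 'a
  proof -
    have red: "x ^ n = x ^ (n mod (q + 1))" for n
    proof -
      have "x ^ n = x ^ ((q + 1) * (n div (q + 1)) + n mod (q + 1))"
        by (simp only: mult_div_mod_eq)
      also have "\<dots> = (x ^ (q + 1)) ^ (n div (q + 1)) * x ^ (n mod (q + 1))"
        by (simp only: power_add [of x "(q + 1) * _"] power_mult)
      finally show ?thesis by (simp only: that power_one mult_1_left)
    qed
    show ?thesis using assms(9) red by (metis cong_def)
  qed
  note lin = linear_factor_power[OF QRS(1)] linear_factor_power[OF QRS(2)]
    linear_factor_power[OF QRS(3)]
  note pw = power_eq_self_or_inverse_of_cong[OF vm]

  \<comment> \<open>The exponents \<open>(i, j)\<close> depend on the sign in the congruences for \<open>Q\<close>, \<open>R\<close>, \<open>S\<close>, the constant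
    \<open>\<kappa>\<close> on how many of the three factors trade \<open>x + v\<close> for \<open>v * x + 1\<close>; neither affects the
    criterion.\<close>
  have criterion: ?permutes
    if \<kappa>: "\<kappa> \<noteq> 0" and ij: "(i, j) = (Q + R, S) \<or> (i, j) = (S, Q + R)"
      and num: "\<And>x. x ^ (q + 1) = 1 \<Longrightarrow> v * (x ^ (Q + R + S) * poly B x ^ q + v * poly B x)
        = - \<kappa> * (x + v) ^ i * (v * x + 1) ^ j"
      and den: "\<And>x. x ^ (q + 1) = 1 \<Longrightarrow> v * (v * (x ^ (Q + R + S) * poly B x ^ q) + poly B x)
        = - \<kappa> * (v * x + 1) ^ i * (x + v) ^ j" for \<kappa> i j
  proof -
    have "permutation_poly f \<longleftrightarrow>
        v ^ q = v \<and> gcd r (q - 1) = 1 \<and> gcd (int i - int j) (int q + 1) = 1"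
      unfolding assms(14)
    proof (rule permutation_poly_iff_of_power_conjugacy[OF assms(4) q assms(8) v(2) vq])
      show "i > 0" "j > 0" using ij pos by auto
      show "- \<kappa> / v \<noteq> 0" using \<kappa> v(1) by simp
    next
      fix x :: 'a assume x: "x ^ (q + 1) = 1"
      show "x ^ r * poly B x ^ q + v * poly B x = - \<kappa> / v * (x + v) ^ i * (v * x + 1) ^ j"
        using num[OF x] v(1) unfolding xr[OF x] by (simp add: field_simps)
      show "v * (x ^ r * poly B x ^ q) + poly B x = - \<kappa> / v * (v * x + 1) ^ i * (x + v) ^ j"
        using den[OF x] v(1) unfolding xr[OF x] by (simp add: field_simps)
    qed
    moreover have "gcd (int i - int j) (int q + 1) = gcd (int Q + int R - int S) (int q + 1)"
      using ij
    proof
      assume "(i, j) = (S, Q + R)"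
      then have "int i - int j = - (int Q + int R - int S)" by simp
      then show ?thesis by (simp only: gcd_neg1_int)
    qed simp
    ultimately show ?thesis using vq_iff by simp
  qed

  assume ?cases
  then consider
      (1) "B = mon (Q + R) - mon (Q + S) - mon (R + S) + smult b (mon S) - 1"
        "cong_pm (int Q, int R, int S) (1, 1, 1) (int m)"
    | (2) "B = mon (R + S) - mon (Q + R) - mon (Q + S) + smult b (mon Q) - 1"
        "cong_pm (int Q, int R, int S) (1, -1, 1) (int m)"
    | (3) "B = mon (Q + R + S) - mon Q - mon R - mon S + [:b:]"
        "cong_pm (int Q, int R, int S) (1, 1, -1) (int m)"
    by blast
  then show ?permutes
  proof cases
    case 1
    have Bx: "poly B x = x^Q * x^R - x^Q * x^S - x^R * x^S + b * x^S - 1" for x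
      by (simp add: 1(1) poly_monom power_add)
    note N = numerator_on_roots_of_unity(2)[OF q(1) _ bq, of _ Q R S, folded 1(1)]
    have num: "v * (x ^ (Q + R + S) * poly B x ^ q + v * poly B x)
        = - (x ^ Q + v) * (x ^ R + v) * (v * x ^ S + 1)" if "x ^ (q + 1) = 1" for x
      unfolding N[OF that] unfolding Bx by (rule trilinear_factorizations(3)[OF v(3)])
    have den: "v * (v * (x ^ (Q + R + S) * poly B x ^ q) + poly B x)
        = - (v * x ^ Q + 1) * (v * x ^ R + 1) * (x ^ S + v)" if "x ^ (q + 1) = 1" for x
      unfolding N[OF that] unfolding Bx by (rule trilinear_factorizations(4)[OF v(3)])
    from 1(2) consider "v ^ Q = v" "v ^ R = v" "v ^ S = v"
      | "v ^ Q * v = 1" "v ^ R * v = 1" "v ^ S * v = 1"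
      by (auto simp: cong_pm_def pw)
    then show ?thesis
    proof cases
      case 1
      show ?thesis
        by (rule criterion[of 1 "Q + R" S])
          (simp_all only: num den lin 1, simp_all add: v(1) power_add mult_ac)
    next
      case 2
      show ?thesis
        by (rule criterion[of "v * v * v" S "Q + R"])
          (simp_all only: num den lin 2, simp_all add: v(1) power_add mult_ac)
    qed
  next
    case 2
    have Bx: "poly B x = x^S * x^R - x^S * x^Q - x^R * x^Q + b * x^Q - 1" for x
      by (simp add: 2(1) poly_monom power_add mult.commute)
    \<comment> \<open>The second shape is the first with \<open>Q\<close> and \<open>S\<close> exchanged.\<close>
    have B: "B = mon (S + R) - mon (S + Q) - mon (R + Q) + smult b (mon Q) - 1"
      by (simp add: 2(1) add.commute)
    have sum: "S + R + Q = Q + R + S" by simp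
    note N = numerator_on_roots_of_unity(2)[OF q(1) _ bq, of _ S R Q, folded B, unfolded sum]
    have num: "v * (x ^ (Q + R + S) * poly B x ^ q + v * poly B x)
        = - (x ^ S + v) * (x ^ R + v) * (v * x ^ Q + 1)" if "x ^ (q + 1) = 1" for x
      unfolding N[OF that] unfolding Bx by (rule trilinear_factorizations(3)[OF v(3)])
    have den: "v * (v * (x ^ (Q + R + S) * poly B x ^ q) + poly B x)
        = - (v * x ^ S + 1) * (v * x ^ R + 1) * (x ^ Q + v)" if "x ^ (q + 1) = 1" for x
      unfolding N[OF that] unfolding Bx by (rule trilinear_factorizations(4)[OF v(3)])
    from 2(2) consider "v ^ Q = v" "v ^ R * v = 1" "v ^ S = v"
      | "v ^ Q * v = 1" "v ^ R = v" "v ^ S * v = 1"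
      by (auto simp: cong_pm_def pw)
    then show ?thesis
    proof cases
      case 1
      show ?thesis
        by (rule criterion[of v S "Q + R"])
          (simp_all only: num den lin 1, simp_all add: v(1) power_add mult_ac)
    next
      case 2
      show ?thesis
        by (rule criterion[of "v * v" "Q + R" S])
          (simp_all only: num den lin 2, simp_all add: v(1) power_add mult_ac)
    qed
  next
    case 3
    have Bx: "poly B x = x^Q * x^R * x^S - x^Q - x^R - x^S + b" for x
      by (simp add: 3(1) poly_monom power_add)
    note N = numerator_on_roots_of_unity(1)[OF q(1) _ bq, of _ Q R S, folded 3(1)]
    have num: "v * (x ^ (Q + R + S) * poly B x ^ q + v * poly B x)
        = - (x ^ Q + v) * (x ^ R + v) * (x ^ S + v)" if "x ^ (q + 1) = 1" for x
      unfolding N[OF that] unfolding Bx by (rule trilinear_factorizations(1)[OF v(3)])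
    have den: "v * (v * (x ^ (Q + R + S) * poly B x ^ q) + poly B x)
        = - (v * x ^ Q + 1) * (v * x ^ R + 1) * (v * x ^ S + 1)" if "x ^ (q + 1) = 1" for x
      unfolding N[OF that] unfolding Bx by (rule trilinear_factorizations(2)[OF v(3)])
    from 3(2) consider "v ^ Q = v" "v ^ R = v" "v ^ S * v = 1"
      | "v ^ Q * v = 1" "v ^ R * v = 1" "v ^ S = v"
      by (auto simp: cong_pm_def pw)
    then show ?thesis
    proof cases
      case 1
      show ?thesis
        by (rule criterion[of v "Q + R" S])
          (simp_all only: num den lin 1, simp_all add: v(1) power_add mult_ac)
    next
      case 2
      show ?thesis
        by (rule criterion[of "v * v" S "Q + R"])
          (simp_all only: num den lin 2, simp_all add: v(1) power_add mult_ac)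
    qed
  qed
qed

end
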